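(* Suppose $f\in\mathcal{A}_C$ and $F'=f$ where $F\in C^0(\overline{\mathbb{R}})$. Let $-\infty\le a<b\le\infty$. If $G\in C^0([a,b])$ then $$\int_{G(a)}^{G(b)}f=\int_a^b(f\circ G)\,G'=(F\circ G)(b)-(F\circ G)(a).$$ If $G\in C^0((a,b))$ and $\lim_{t\to a^+}G(t)=-\infty$ and $\lim_{t\to b^-}G(t)=\infty$ then $$\int_{-\infty}^\infty f=\int_a^b(f\circ G)\,G'=F(\infty)-F(-\infty).$$
   Context: $\mathcal{D}=C_c^\infty(\mathbb{R})$ (real-valued), $\mathcal{D}'$ is the space of distributions, $\langle T',\phi\rangle=-\langle T,\phi'\rangle$; similarly $\mathcal{D}(I)$, $\mathcal{D}'(I)$ for an open interval $I$. Functions are identified with distributions in the usual way. $\overline{\mathbb{R}}=[-\infty,\infty]$. For $-\infty\le a<b\le\infty$, $C^0([a,b])$ denotes the real-valued continuous functions on $[a,b]\subset\overline{\mathbb{R}}$ (so real limits are required at an infinite endpoint, and the value there is the limit); in particular $C^0(\overline{\mathbb{R}})$ is the case $a=-\infty$, $b=\infty$. $\mathcal{B}_C=\{F\in C^0(\overline{\mathbb{R}}): F(-\infty)=0\}$ and $\mathcal{A}_C=\{f\in\mathcal{D}': f=F' \text{ for some } F\in\mathcal{B}_C\}$. For $f\in\mathcal{A}_C$ and $\alpha,\beta\in\overline{\mathbb{R}}$ (in either order), $\int_\alpha^\beta f=F(\beta)-F(\alpha)$ for any $F\in C^0(\overline{\mathbb{R}})$ with $F'=f$. More generally, $h\in\mathcal{D}'((a,b))$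 is integrable on $[a,b]$ if there is $H\in C^0([a,b])$ with $H'=h$ in $\mathcal{D}'((a,b))$, and then $\int_a^b h=H(b)-H(a)$. Definition of $(f\circ G)G'$: for $F$ continuous with $F'=f$ and $G$ continuous, the distribution $(f\circ G)\,G'=(F'\circ G)\,G'$ is defined to be the distributional derivative $(F\circ G)'$, i.e. $\langle (F'\circ G)G',\phi\rangle=-\int (F\circ G)(t)\,\phi'(t)\,dt$ for all test functions $\phi$ (with support in $(a,b)$, the interval on which $G$ is considered). *)

theory Defs
  imports "HOL-Analysis.Analysis"
begin

definition real_interval :: "ereal \<Rightarrow> ereal \<Rightarrow> real set" where
  "real_interval a b = {x. a < ereal x \<and> ereal x < b}"

definition smooth :: "(real \<Rightarrow> real) \<Rightarrow> bool" where
  "smooth \<phi> \<longleftrightarrow> (\<forall>n x. (deriv ^^ n) \<phi> field_differentiable at x)"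

definition supp :: "(real \<Rightarrow> real) \<Rightarrow> real set" where
  "supp \<phi> = closure {x. \<phi> x \<noteq> 0}"

text \<open>
  Test functions on \<open>(a, b)\<close> are represented by their extension by zero to the real line.
\<close>

definition test_functions :: "ereal \<Rightarrow> ereal \<Rightarrow> (real \<Rightarrow> real) set" where
  "test_functions a b = {\<phi>. smooth \<phi> \<and> compact (supp \<phi>) \<and> supp \<phi> \<subseteq> real_interval a b}"

definition test_converges ::
    "ereal \<Rightarrow> ereal \<Rightarrow> (nat \<Rightarrow> real \<Rightarrow> real) \<Rightarrow> (real \<Rightarrow> real) \<Rightarrow> bool" where
  "test_converges a b \<phi> \<psi> \<longleftrightarrow>
     (\<forall>n. \<phi> n \<in> test_functions a b) \<and> \<psi> \<in> test_functions a b \<and>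
     (\<exists>K. compact K \<and> K \<subseteq> real_interval a b \<and> (\<forall>n. supp (\<phi> n) \<subseteq> K)) \<and>
     (\<forall>m. uniform_limit UNIV (\<lambda>n. (deriv ^^ m) (\<phi> n)) ((deriv ^^ m) \<psi>) sequentially)"

text \<open>
  Distributions are made \<open>extensional\<close>, so that HOL equality of two distributions on
  \<open>(a, b)\<close> is equality on all test functions on \<open>(a, b)\<close>.
\<close>

definition distributions :: "ereal \<Rightarrow> ereal \<Rightarrow> ((real \<Rightarrow> real) \<Rightarrow> real) set" where
  "distributions a b = {T \<in> extensional (test_functions a b).
     (\<forall>\<phi>\<in>test_functions a b. \<forall>\<psi>\<in>test_functions a b. \<forall>c d.
        T (\<lambda>x. c * \<phi> x + d * \<psi> x) = c * T \<phi> + d * T \<psi>) \<and>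
     (\<forall>\<phi> \<psi>. test_converges a b \<phi> \<psi> \<longrightarrow> (\<lambda>n. T (\<phi> n)) \<longlonglongrightarrow> T \<psi>)}"

definition distr_of_fun :: "ereal \<Rightarrow> ereal \<Rightarrow> (real \<Rightarrow> real) \<Rightarrow> (real \<Rightarrow> real) \<Rightarrow> real" where
  "distr_of_fun a b g = (\<lambda>\<phi>\<in>test_functions a b. LINT x:real_interval a b|lborel. g x * \<phi> x)"

definition distr_deriv ::
    "ereal \<Rightarrow> ereal \<Rightarrow> ((real \<Rightarrow> real) \<Rightarrow> real) \<Rightarrow> (real \<Rightarrow> real) \<Rightarrow> real" where
  "distr_deriv a b T = (\<lambda>\<phi>\<in>test_functions a b. - T (deriv \<phi>))"

text \<open>
  Continuity on a closed interval refers to the order topology of \<^typ>\<open>ereal\<close>, so at an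
  infinite endpoint it says that the real limit exists and is the value there.
\<close>

definition C0 :: "ereal \<Rightarrow> ereal \<Rightarrow> (ereal \<Rightarrow> real) set" where
  "C0 a b = {H. continuous_on {a..b} H}"

definition is_primitive ::
    "ereal \<Rightarrow> ereal \<Rightarrow> (ereal \<Rightarrow> real) \<Rightarrow> ((real \<Rightarrow> real) \<Rightarrow> real) \<Rightarrow> bool" where
  "is_primitive a b H h \<longleftrightarrow> H \<in> C0 a b \<and> distr_deriv a b (distr_of_fun a b (\<lambda>x. H (ereal x))) = h"

definition B_C :: "(ereal \<Rightarrow> real) set" where
  "B_C = {F \<in> C0 (-\<infinity>) \<infinity>. F (-\<infinity>) = 0}"

definition A_C :: "((real \<Rightarrow> real) \<Rightarrow> real) set" where
  "A_C = {f \<in> distributions (-\<infinity>) \<infinity>.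
     \<exists>F\<in>B_C. f = distr_deriv (-\<infinity>) \<infinity> (distr_of_fun (-\<infinity>) \<infinity> (\<lambda>x. F (ereal x)))}"

text \<open>
  Primitives are unique up to an additive constant, which makes the definite descriptions
  below well defined. The limits \<open>\<alpha>\<close> and \<open>\<beta>\<close> may be in either order.
\<close>

definition A_C_integral :: "ereal \<Rightarrow> ereal \<Rightarrow> ((real \<Rightarrow> real) \<Rightarrow> real) \<Rightarrow> real" where
  "A_C_integral \<alpha> \<beta> f = (THE I. \<exists>F. is_primitive (-\<infinity>) \<infinity> F f \<and> I = F \<beta> - F \<alpha>)"

definition distr_integrable :: "ereal \<Rightarrow> ereal \<Rightarrow> ((real \<Rightarrow> real) \<Rightarrow> real) \<Rightarrow> bool" where
  "distr_integrable a b h \<longleftrightarrow> h \<in> distributions a b \<and> (\<exists>H. is_primitive a b H h)"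

definition distr_integral :: "ereal \<Rightarrow> ereal \<Rightarrow> ((real \<Rightarrow> real) \<Rightarrow> real) \<Rightarrow> real" where
  "distr_integral a b h = (THE I. \<exists>H. is_primitive a b H h \<and> I = H b - H a)"

text \<open>
  The distribution \<open>(f \<circ> G) G'\<close> on \<open>(a, b)\<close>, that is \<open>(F \<circ> G)'\<close> for any continuous
  \<open>F\<close> on the real line with \<open>F' = f\<close>; it does not depend on the choice of \<open>F\<close>.
\<close>

definition distr_subst ::
    "ereal \<Rightarrow> ereal \<Rightarrow> ((real \<Rightarrow> real) \<Rightarrow> real) \<Rightarrow> (real \<Rightarrow> real) \<Rightarrow> (real \<Rightarrow> real) \<Rightarrow> real" where
  "distr_subst a b f G = (THE h. \<exists>F::real \<Rightarrow> real. continuous_on UNIV F \<and>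
     distr_deriv (-\<infinity>) \<infinity> (distr_of_fun (-\<infinity>) \<infinity> F) = f \<and>
     h = distr_deriv a b (distr_of_fun a b (F \<circ> G)))"

end

theory Submission
  imports Defs
begin

text \<open>
  A primitive of \<open>(f \<circ> G) G'\<close> is \<open>F \<circ> G\<close>, extended to the endpoints by continuity (by \<open>F (\<plusminus>\<infinity>)\<close> when
  \<open>G\<close> tends to \<open>\<plusminus>\<infinity>\<close>), so the formula holds as soon as the integrals and the substituted distribution are
  well defined. They are because a continuous function with zero distributional derivative is constant.
\<close>

text \<open>No chain rule is available, since \<open>G\<close> is merely continuous and
  \<open>F \<circ> G\<close> may be nowhere differentiable; \<open>(f \<circ> G) G'\<close> is by
  definition the distributional derivative of \<open>F \<circ> G\<close>. The work lies in the
  definite descriptions: \<open>A_C_integral\<close>, \<open>distr_integral\<close> and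
  \<open>distr_subst\<close> say nothing until their values are shown to be unique. Two primitives
  of one distribution must differ by a constant, and composing with \<open>G\<close> turns that
  constant into the same constant. To show this, enough test functions must exist, which forces an
  explicit smooth function of compact support, built from exp(-1/x). Smoothness is stated through
  iterates of \<open>deriv\<close>, so each construction needs a class of functions that is stable
  under differentiation.\<close>

section \<open>Smooth functions\<close>

text \<open>The map \<open>D\<close> on indices mirrors differentiation, so the n-th derivative of
  \<open>h i\<close> is again a member of the family, at index \<open>(D ^^ n) i\<close>. This
  replaces explicit formulas for higher derivatives in all constructions below.\<close>

lemma smooth_family:
  assumes "i \<in> I"
    and closed: "\<And>i. i \<in> I \<Longrightarrow> D i \<in> I"
    and deriv: "\<And>i x. i \<in> I \<Longrightarrow> (h i has_field_derivative h (D i) x) (at x)"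
  shows "smooth (h i)"
proof -
  have in_I: "(D ^^ n) i \<in> I" for n
    by (induction n) (simp_all add: \<open>i \<in> I\<close> closed)
  have "deriv (h j) = h (D j)" if "j \<in> I" for j
    using deriv[OF that] by (intro ext DERIV_imp_deriv)
  then have "(deriv ^^ n) (h i) = h ((D ^^ n) i)" for n
    by (induction n) (simp_all add: in_I)
  then show ?thesis
    unfolding smooth_def field_differentiable_def using deriv[OF in_I] by metis
qed

lemma smooth_deriv:
  assumes "smooth \<phi>"
  shows "smooth (deriv \<phi>)"
proof -
  have "(deriv ^^ n) (deriv \<phi>) = (deriv ^^ Suc n) \<phi>" for n
    by (simp add: funpow_Suc_right del: funpow.simps(2))
  with assms show ?thesis by (simp add: smooth_def del: funpow.simps(2))
qed

lemma smooth_has_derivative: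
  assumes "smooth \<phi>"
  shows "(\<phi> has_field_derivative deriv \<phi> x) (at x)"
proof -
  have "(deriv ^^ 0) \<phi> field_differentiable at x"
    using assms unfolding smooth_def by blast
  then show ?thesis by (simp add: DERIV_deriv_iff_field_differentiable)
qed

lemma smooth_continuous: "smooth \<phi> \<Longrightarrow> continuous_on A \<phi>"
  by (intro continuous_at_imp_continuous_on ballI DERIV_isCont[OF smooth_has_derivative])

lemma smooth_antiderivative:
  assumes g: "\<And>x. (g has_field_derivative \<phi> x) (at x)" and \<phi>: "smooth \<phi>"
  shows "smooth g"
proof -
  have "deriv g = \<phi>"
    using g by (intro ext DERIV_imp_deriv)
  then have "(deriv ^^ n) g field_differentiable at x" for n x
  proof (cases n)
    case 0
    then show ?thesis using g by (auto simp: field_differentiable_def)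
  next
    case (Suc m)
    then have "(deriv ^^ n) g = (deriv ^^ m) \<phi>"
      using \<open>deriv g = \<phi>\<close> by (simp add: funpow_Suc_right del: funpow.simps(2))
    then show ?thesis using \<phi> by (simp add: smooth_def)
  qed
  then show ?thesis by (simp add: smooth_def)
qed

lemma smooth_linear:
  assumes "smooth \<phi>" "smooth \<psi>"
  shows "smooth (\<lambda>x. c * \<phi> x + d * \<psi> x)"
proof -
  define h where "h = (\<lambda>(f, g) x :: real. c * f x + d * g x :: real)"
  have "smooth (h (\<phi>, \<psi>))"
  proof (rule smooth_family)
    show "(\<phi>, \<psi>) \<in> Collect smooth \<times> Collect smooth"
      using assms by simp
    show "map_prod deriv deriv i \<in> Collect smooth \<times> Collect smooth"
      if "i \<in> Collect smooth \<times> Collect smooth" for i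
      using that by (auto intro: smooth_deriv)
    show "(h i has_field_derivative h (map_prod deriv deriv i) x) (at x)"
      if "i \<in> Collect smooth \<times> Collect smooth" for i x
      using that by (auto simp: h_def intro!: DERIV_add DERIV_cmult smooth_has_derivative)
  qed
  then show ?thesis by (simp add: h_def)
qed

lemma smooth_affine:
  assumes "smooth \<phi>"
  shows "smooth (\<lambda>x. \<phi> (s * x + t))"
proof -
  \<comment> \<open>The chain rule yields a factor \<open>s\<close> at each differentiation; the
    first component of the index accumulates these factors.\<close>
  define h where "h = (\<lambda>(c, f) x. c * f (s * x + t) :: real)"
  have "smooth (h (1, \<phi>))"
  proof (rule smooth_family)
    show "(1, \<phi>) \<in> UNIV \<times> Collect smooth"
      using assms by simp
    show "map_prod ((*) s) deriv i \<in> UNIV \<times> Collect smooth" if "i \<in> UNIV \<times> Collect smooth" for i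
      using that by (auto intro: smooth_deriv)
    fix i :: "real \<times> (real \<Rightarrow> real)" and x assume "i \<in> UNIV \<times> Collect smooth"
    then obtain c f where i: "i = (c, f)" "smooth f" by auto
    have "((\<lambda>x. s * x + t) has_field_derivative s) (at x)"
      by (auto intro!: derivative_eq_intros)
    then have "((\<lambda>x. f (s * x + t)) has_field_derivative deriv f (s * x + t) * s) (at x)"
      by (rule DERIV_chain2[OF smooth_has_derivative[OF i(2)]])
    then show "(h i has_field_derivative h (map_prod ((*) s) deriv i) x) (at x)"
      using DERIV_cmult[of "\<lambda>x. f (s * x + t)" "deriv f (s * x + t) * s" x UNIV c]
      by (simp add: i h_def mult.assoc mult.commute[of s])
  qed
  then show ?thesis by (simp add: h_def)
qed

text \<open>Products alone are not stable under differentiation, but sums of products are. Working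
  with this class avoids the general Leibniz formula.\<close>

inductive sum_of_smooth_products :: "(real \<Rightarrow> real) \<Rightarrow> bool" where
  prod: "smooth f \<Longrightarrow> smooth g \<Longrightarrow> sum_of_smooth_products (\<lambda>x. f x * g x)"
| add: "sum_of_smooth_products f \<Longrightarrow> sum_of_smooth_products g \<Longrightarrow>
    sum_of_smooth_products (\<lambda>x. f x + g x)"

lemma sum_of_smooth_products_deriv:
  assumes "sum_of_smooth_products h"
  shows "sum_of_smooth_products (deriv h) \<and> (\<forall>x. (h has_field_derivative deriv h x) (at x))"
  using assms
proof induction
  case (prod f g)
  have D: "((\<lambda>x. f x * g x) has_field_derivative f x * deriv g x + deriv f x * g x) (at x)" for x
    by (intro DERIV_mult' smooth_has_derivative prod)
  then have "deriv (\<lambda>x. f x * g x) = (\<lambda>x. f x * deriv g x + deriv f x * g x)"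
    by (intro ext DERIV_imp_deriv)
  moreover have "sum_of_smooth_products (\<lambda>x. f x * deriv g x + deriv f x * g x)"
    by (intro sum_of_smooth_products.add sum_of_smooth_products.prod smooth_deriv prod)
  ultimately show ?case using D by simp
next
  case (add f g)
  then have D: "((\<lambda>x. f x + g x) has_field_derivative deriv f x + deriv g x) (at x)" for x
    by (intro DERIV_add) auto
  then have "deriv (\<lambda>x. f x + g x) = (\<lambda>x. deriv f x + deriv g x)"
    by (intro ext DERIV_imp_deriv)
  moreover have "sum_of_smooth_products (\<lambda>x. deriv f x + deriv g x)"
    using add.IH by (intro sum_of_smooth_products.add) auto
  ultimately show ?case using D by simp
qed

lemma smooth_mult:
  assumes "smooth \<phi>" "smooth \<psi>"
  shows "smooth (\<lambda>x. \<phi> x * \<psi> x)"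
  by (rule smooth_family[where h = "\<lambda>f. f" and D = deriv and I = "Collect sum_of_smooth_products"])
     (simp_all add: sum_of_smooth_products_deriv sum_of_smooth_products.prod assms)

section \<open>The smooth function exp(-1/x) and bump functions\<close>

text \<open>The polynomial factor makes the family closed under differentiation.\<close>

definition flat :: "real poly \<Rightarrow> real \<Rightarrow> real" where
  "flat p x = (if x > 0 then poly p (1 / x) * exp (- (1 / x)) else 0)"

text \<open>The free power \<open>k\<close> carries the induction: y^k (c + y p(y)) splits into c
  y^k and y^(k+1) p(y).\<close>

lemma power_poly_exp_tendsto_0: "((\<lambda>y::real. y ^ k * poly p y * exp (- y)) \<longlongrightarrow> 0) at_top"
proof (induction p arbitrary: k)
  case 0
  show ?case by simp
next
  case (pCons c p)
  have "((\<lambda>y. c * (y ^ k / exp y) + y ^ Suc k * poly p y * exp (- y)) \<longlongrightarrow> c * 0 + 0) at_top"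
    by (intro tendsto_intros tendsto_power_div_exp_0 pCons.IH)
  then show ?case
    by (simp add: algebra_simps exp_minus divide_inverse)
qed

text \<open>With y = 1/x, differentiation in x is -y^2 times differentiation in y, which sends p(y)
  exp(-y) to y^2 (p - p')(y) exp(-y). The factor \<open>[:0, 0, 1:]\<close> is y^2.\<close>

lemma flat_has_derivative:
  "(flat p has_field_derivative flat ([:0, 0, 1:] * (p - pderiv p)) x) (at x)"
proof -
  consider "x < 0" | "x > 0" | "x = 0" by linarith
  then show ?thesis
  proof cases
    case 1
    have "((\<lambda>_. 0) has_field_derivative 0) (at x)" by simp
    then have "(flat p has_field_derivative 0) (at x)"
      by (rule has_field_derivative_transform_within_open[where S = "{..<0}"]) (use 1 in \<open>auto simp: flat_def\<close>)
    with 1 show ?thesis by (simp add: flat_def)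
  next
    case 2
    have inv: "((\<lambda>x. 1 / x) has_field_derivative - (1 / x)\<^sup>2) (at x)"
      using 2 by (auto intro!: derivative_eq_intros simp: power2_eq_square)
    have "((\<lambda>x. poly p (1 / x) * exp (- (1 / x))) has_field_derivative
        poly p (1 / x) * (exp (- (1 / x)) * - (- (1 / x)\<^sup>2))
        + poly (pderiv p) (1 / x) * - (1 / x)\<^sup>2 * exp (- (1 / x))) (at x)"
      by (rule DERIV_mult'[OF DERIV_chain2[OF poly_DERIV inv] DERIV_fun_exp[OF DERIV_minus[OF inv]]])
    then have "((\<lambda>x. poly p (1 / x) * exp (- (1 / x))) has_field_derivative
        poly ([:0, 0, 1:] * (p - pderiv p)) (1 / x) * exp (- (1 / x))) (at x)"
      by (simp add: algebra_simps power2_eq_square)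
    then have "(flat p has_field_derivative
        poly ([:0, 0, 1:] * (p - pderiv p)) (1 / x) * exp (- (1 / x))) (at x)"
      by (rule has_field_derivative_transform_within_open[where S = "{0<..}"]) (use 2 in \<open>auto simp: flat_def\<close>)
    with 2 show ?thesis by (simp add: flat_def)
  next
    case 3
    have "((\<lambda>h. flat p h / h) \<longlongrightarrow> 0) (at_left 0)"
      by (rule tendsto_eventually) (auto simp: flat_def eventually_at_filter)
    moreover have "((\<lambda>h. flat p h / h) \<longlongrightarrow> 0) (at_right 0)"
    proof -
      \<comment> \<open>The exponent 1 comes from dividing by \<open>h\<close> in the difference
        quotient at 0, where the function value is 0.\<close>
      have "((\<lambda>h::real. inverse h ^ 1 * poly p (inverse h) * exp (- inverse h)) \<longlongrightarrow> 0) (at_right 0)"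
        by (rule filterlim_compose[OF power_poly_exp_tendsto_0 filterlim_inverse_at_top_right])
      then show ?thesis
        by (rule Lim_transform_eventually)
           (auto simp: flat_def eventually_at_filter field_simps)
    qed
    ultimately have "((\<lambda>h. flat p h / h) \<longlongrightarrow> 0) (at 0)"
      by (simp add: filterlim_split_at)
    with 3 show ?thesis
      by (simp add: DERIV_def flat_def[of _ 0])
  qed
qed

lemma smooth_flat: "smooth (flat p)"
  by (rule smooth_family[where I = UNIV and h = flat and D = "\<lambda>p. [:0, 0, 1:] * (p - pderiv p)"])
     (simp_all only: UNIV_I flat_has_derivative)

lemma smooth_bump_exists:
  fixes e :: real
  assumes "e > 0"
  obtains \<beta> :: "real \<Rightarrow> real" where "smooth \<beta>" "\<And>x. \<bar>x\<bar> < e \<Longrightarrow> \<beta> x > 0" "\<And>x. \<bar>x\<bar> \<ge> e \<Longrightarrow> \<beta> x = 0"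
proof
  \<comment> \<open>The first factor is positive exactly for x > -e, the second exactly for x < e.
    The unsimplified \<open>1 * x\<close> and \<open>- 1 * x\<close> match the shape of
    \<open>smooth_affine\<close>.\<close>
  show "smooth (\<lambda>x. flat 1 (1 * x + e) * flat 1 (- 1 * x + e))"
    by (intro smooth_mult smooth_affine smooth_flat)
  show "flat 1 (1 * x + e) * flat 1 (- 1 * x + e) > 0" if "\<bar>x\<bar> < e" for x
    using that by (simp add: flat_def)
  show "flat 1 (1 * x + e) * flat 1 (- 1 * x + e) = 0" if "\<bar>x\<bar> \<ge> e" for x
    using that by (auto simp: flat_def)
qed

lemma continuous_has_antiderivative:
  fixes f :: "real \<Rightarrow> real"
  assumes "continuous_on UNIV f"
  obtains g where "\<And>x. (g has_field_derivative f x) (at x)"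
proof -
  have "\<exists>g. \<forall>x. -\<infinity> < ereal x \<longrightarrow> ereal x < \<infinity> \<longrightarrow> (g has_vector_derivative f x) (at x)"
    using assms by (intro einterval_antiderivative) (simp_all add: continuous_on_eq_continuous_at)
  then show ?thesis
    using that by (auto simp: has_real_derivative_iff_has_vector_derivative)
qed

section \<open>Pairing test functions with continuous functions\<close>

lemma open_real_interval [simp]: "open (real_interval a b)"
proof -
  have "real_interval a b = ereal -` {a<..<b}"
    by (auto simp: real_interval_def)
  then show ?thesis by (simp add: open_ereal_vimage)
qed

lemma real_interval_convex:
  assumes "p \<in> real_interval a b" "q \<in> real_interval a b"
  shows "{p..q} \<subseteq> real_interval a b"
proof
  fix x assume "x \<in> {p..q}"
  then have "ereal p \<le> ereal x" "ereal x \<le> ereal q" by simp_all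
  with assms show "x \<in> real_interval a b"
    unfolding real_interval_def mem_Collect_eq by (meson le_less_trans less_le_trans)
qed

lemma real_interval_UNIV [simp]: "real_interval (-\<infinity>) \<infinity> = UNIV"
  by (auto simp: real_interval_def)

lemma supp_closed [simp]: "closed (supp \<phi>)"
  by (simp add: supp_def)

lemma not_in_supp: "x \<notin> supp \<phi> \<Longrightarrow> \<phi> x = 0"
  using closure_subset[of "{x. \<phi> x \<noteq> 0}"] by (auto simp: supp_def)

lemma supp_minimal: "closed K \<Longrightarrow> (\<And>x. x \<notin> K \<Longrightarrow> \<phi> x = 0) \<Longrightarrow> supp \<phi> \<subseteq> K"
  unfolding supp_def by (rule closure_minimal) auto

lemma supp_deriv: "supp (deriv \<phi>) \<subseteq> supp \<phi>"
proof (rule supp_minimal)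
  fix x assume x: "x \<notin> supp \<phi>"
  have "((\<lambda>_. 0) has_field_derivative 0) (at x)" by simp
  then have "(\<phi> has_field_derivative 0) (at x)"
    by (rule has_field_derivative_transform_within_open[where S = "- supp \<phi>"])
       (use x in \<open>auto simp: not_in_supp open_Compl\<close>)
  then show "deriv \<phi> x = 0" by (rule DERIV_imp_deriv)
qed simp

section \<open>Test functions and their integrals\<close>

lemma test_functionsI:
  assumes "smooth \<phi>" "compact K" "K \<subseteq> real_interval a b" "\<And>x. x \<notin> K \<Longrightarrow> \<phi> x = 0"
  shows "\<phi> \<in> test_functions a b"
proof -
  have "supp \<phi> \<subseteq> K"
    using assms by (intro supp_minimal) (auto simp: compact_imp_closed)
  moreover from this have "compact (supp \<phi>)"
    using assms(2) by (metis compact_Int_closed inf.absorb2 supp_closed)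
  ultimately show ?thesis
    using assms by (auto simp: test_functions_def)
qed

lemma deriv_test_function: "\<phi> \<in> test_functions a b \<Longrightarrow> deriv \<phi> \<in> test_functions a b"
  using not_in_supp[of _ "deriv \<phi>"] supp_deriv[of \<phi>]
  by (intro test_functionsI[where K = "supp \<phi>"]) (auto simp: test_functions_def smooth_deriv)

lemma linear_test_function:
  assumes "\<phi> \<in> test_functions a b" "\<psi> \<in> test_functions a b"
  shows "(\<lambda>x. c * \<phi> x + d * \<psi> x) \<in> test_functions a b"
  by (rule test_functionsI[where K = "supp \<phi> \<union> supp \<psi>"])
     (use assms in \<open>auto simp: test_functions_def smooth_linear not_in_supp\<close>)

lemma test_function_has_derivative:
  "\<phi> \<in> test_functions a b \<Longrightarrow> (\<phi> has_field_derivative deriv \<phi> x) (at x)"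
  by (simp add: test_functions_def smooth_has_derivative)

text \<open>\<open>u\<close> is uncontrolled at the ends of the interval and outside it, but the
  support of \<open>\<phi>\<close> is compact inside. The product is continuous on two open sets
  covering the line: the interval, and the complement of the support, where it vanishes.\<close>

lemma continuous_pairing:
  assumes "continuous_on (real_interval a b) u" "\<phi> \<in> test_functions a b"
  shows "continuous_on UNIV (\<lambda>x. indicator (real_interval a b) x *\<^sub>R (u x * \<phi> x))"
proof -
  let ?f = "\<lambda>x. indicator (real_interval a b) x *\<^sub>R (u x * \<phi> x)"
  have "continuous_on (real_interval a b) (\<lambda>x. u x * \<phi> x)"
    using assms by (intro continuous_on_mult smooth_continuous[of \<phi>]) (auto simp: test_functions_def)
  then have "continuous_on (real_interval a b) ?f"
    by (subst continuous_on_cong[OF refl, where g = "\<lambda>x. u x * \<phi> x"]) auto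
  moreover have "continuous_on (- supp \<phi>) ?f"
    by (subst continuous_on_cong[OF refl, where g = "\<lambda>_. 0"]) (auto simp: not_in_supp)
  ultimately have "continuous_on (real_interval a b \<union> - supp \<phi>) ?f"
    by (intro continuous_on_open_Un) (auto simp: open_Compl)
  moreover have "real_interval a b \<union> - supp \<phi> = UNIV"
    using assms(2) by (auto simp: test_functions_def)
  ultimately show ?thesis by simp
qed

lemma integrable_pairing:
  assumes "continuous_on (real_interval a b) u" "\<phi> \<in> test_functions a b"
  shows "set_integrable lborel (real_interval a b) (\<lambda>x. u x * \<phi> x)"
proof -
  let ?f = "\<lambda>x. indicator (real_interval a b) x *\<^sub>R (u x * \<phi> x)"
  have "integrable lborel (\<lambda>x. indicator (supp \<phi>) x *\<^sub>R ?f x)"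
    using assms(2) continuous_pairing[OF assms]
    by (intro borel_integrable_compact) (auto simp: test_functions_def intro: continuous_on_subset)
  also have "(\<lambda>x. indicator (supp \<phi>) x *\<^sub>R ?f x) = ?f"
    using not_in_supp[of _ \<phi>] by (fastforce simp: indicator_def)
  finally show ?thesis by (simp add: set_integrable_def)
qed

lemma integral_deriv_test_function:
  assumes "\<phi> \<in> test_functions a b"
  shows "(LINT x:real_interval a b|lborel. deriv \<phi> x) = 0"
proof -
  have "bounded (supp \<phi>)"
    using assms by (auto simp: test_functions_def compact_imp_bounded)
  then obtain M where M: "M > 0" "\<And>x. x \<in> supp \<phi> \<Longrightarrow> \<bar>x\<bar> \<le> M"
    by (auto simp: bounded_pos)
  have 0: "deriv \<phi> x = 0" if "x \<notin> supp \<phi>" for x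
    using that supp_deriv by (intro not_in_supp) blast
  \<comment> \<open>The support lies in [-M, M], so the points M + 1 and -(M + 1) are strictly
    outside it and both boundary terms vanish.\<close>
  have "(LINT x:real_interval a b|lborel. deriv \<phi> x)
      = (LINT x|lborel. indicator {- (M + 1)..M + 1} x *\<^sub>R deriv \<phi> x)"
    unfolding set_lebesgue_integral_def
  proof (rule Bochner_Integration.integral_cong[OF refl])
    fix x
    show "indicator (real_interval a b) x *\<^sub>R deriv \<phi> x = indicator {- (M + 1)..M + 1} x *\<^sub>R deriv \<phi> x"
      using assms M(2)[of x] 0[of x]
      by (cases "x \<in> supp \<phi>") (auto simp: test_functions_def indicator_def)
  qed
  also have "\<dots> = \<phi> (M + 1) - \<phi> (- (M + 1))"
    using M(1) deriv_test_function[OF assms] test_function_has_derivative[OF assms]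
    by (intro integral_FTC_atLeastAtMost)
       (auto simp: test_functions_def smooth_continuous has_real_derivative_iff_has_vector_derivative
         intro: has_vector_derivative_at_within)
  also have "\<dots> = 0"
    using M(1) M(2)[of "M + 1"] M(2)[of "- (M + 1)"] not_in_supp[of "M + 1" \<phi>]
      not_in_supp[of "- (M + 1)" \<phi>] by fastforce
  finally show ?thesis .
qed

section \<open>Continuous functions with zero distributional derivative\<close>

text \<open>The zero set has full measure, and by continuity it is closed; a closed set of full
  measure is the whole line.\<close>

lemma continuous_nonneg_integral_zero:
  fixes f :: "real \<Rightarrow> real"
  assumes "continuous_on UNIV f" "integrable lborel f" "\<And>x. f x \<ge> 0" "integral\<^sup>L lborel f = 0"
  shows "f x = 0"
proof -
  have "AE x in lborel. f x = 0"
    using integral_nonneg_eq_0_iff_AE[OF assms(2)] assms(3,4) by blast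
  then have "AE x in lebesgue. x \<in> {x. f x = 0}"
    by (simp add: AE_completion)
  moreover have "closed {x. f x = 0}"
    using assms(1) by (intro closed_Collect_eq) auto
  ultimately show ?thesis
    using mem_closed_if_AE_lebesgue by blast
qed

text \<open>Du Bois-Reymond: translating the antiderivative \<open>\<Phi>\<close> of a bump gives the test function
  \<open>\<Phi> (x - p) - \<Phi> (x - q)\<close>, whose derivative is concentrated near \<open>p\<close> and \<open>q\<close> with opposite signs.
  If \<open>u\<close> took values below \<open>m\<close> near \<open>p\<close> and above \<open>m\<close> near \<open>q\<close>, its pairing with \<open>u - m\<close> could not vanish.\<close>

lemma zero_distributional_derivative_le:
  assumes u: "continuous_on (real_interval a b) u"
    and zero: "\<And>\<phi>. \<phi> \<in> test_functions a b \<Longrightarrow> (LINT x:real_interval a b|lborel. u x * deriv \<phi> x) = 0"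
    and p: "p \<in> real_interval a b" and q: "q \<in> real_interval a b"
  shows "u q \<le> u p"
proof (rule ccontr)
  let ?I = "real_interval a b"
  assume "\<not> u q \<le> u p"
  then obtain m where m: "u p < m" "m < u q"
    using dense by (meson not_le)
  have "open (?I \<inter> u -` {..<m})" "open (?I \<inter> u -` {m<..})"
    by (auto intro: continuous_open_preimage u)
  then obtain e1 e2 where e1: "e1 > 0" "cball p e1 \<subseteq> ?I \<inter> u -` {..<m}"
    and e2: "e2 > 0" "cball q e2 \<subseteq> ?I \<inter> u -` {m<..}"
    using m p q by (metis IntI greaterThan_iff lessThan_iff open_contains_cball vimageI)
  define e where "e = min e1 e2"
  have e: "e > 0" and near_p: "\<And>x. \<bar>x - p\<bar> \<le> e \<Longrightarrow> x \<in> ?I \<and> u x < m"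
    and near_q: "\<And>x. \<bar>x - q\<bar> \<le> e \<Longrightarrow> x \<in> ?I \<and> u x > m"
    using e1 e2 by (auto simp: e_def subset_iff dist_real_def abs_minus_commute)
  obtain \<beta> where \<beta>: "smooth \<beta>" "\<And>x. \<bar>x\<bar> < e \<Longrightarrow> \<beta> x > 0" "\<And>x. \<bar>x\<bar> \<ge> e \<Longrightarrow> \<beta> x = 0"
    using smooth_bump_exists[OF e] by blast
  obtain \<Phi> where \<Phi>: "\<And>x. (\<Phi> has_field_derivative \<beta> x) (at x)"
    using continuous_has_antiderivative[OF smooth_continuous[OF \<beta>(1)]] by blast
  \<comment> \<open>\<open>\<beta>\<close> vanishes outside (-e, e), so \<open>\<Phi>\<close> is
    constant on each side. Far to the left, and likewise far to the right, both translates of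
    \<open>\<Phi>\<close> take the same constant value and cancel, which gives their difference
    compact support.\<close>
  have left: "\<Phi> x = \<Phi> (- e)" if "x \<le> - e" for x
  proof (rule ccontr)
    assume "\<Phi> x \<noteq> \<Phi> (- e)"
    with that have "x < - e" by (cases "x = - e") auto
    then obtain z where "x < z" "z < - e" "\<Phi> (- e) - \<Phi> x = (- e - x) * \<beta> z"
      using MVT2[of x "- e" \<Phi> \<beta>] \<Phi> by blast
    with \<beta>(3)[of z] \<open>\<Phi> x \<noteq> \<Phi> (- e)\<close> show False by simp
  qed
  have right: "\<Phi> x = \<Phi> e" if "x \<ge> e" for x
  proof (rule ccontr)
    assume "\<Phi> x \<noteq> \<Phi> e"
    with that have "e < x" by (cases "x = e") auto
    then obtain z where "e < z" "z < x" "\<Phi> x - \<Phi> e = (x - e) * \<beta> z"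
      using MVT2[of e x \<Phi> \<beta>] \<Phi> by blast
    with \<beta>(3)[of z] \<open>\<Phi> x \<noteq> \<Phi> e\<close> show False by simp
  qed
  define \<phi> where "\<phi> = (\<lambda>x. 1 * \<Phi> (1 * x + - p) + - 1 * \<Phi> (1 * x + - q))"
  have "smooth \<phi>"
    unfolding \<phi>_def by (intro smooth_linear smooth_affine smooth_antiderivative[OF \<Phi> \<beta>(1)])
  moreover have "{min p q - e..max p q + e} \<subseteq> ?I"
    using near_p[of "p - e"] near_p[of "p + e"] near_q[of "q - e"] near_q[of "q + e"] e
    by (intro real_interval_convex) (auto simp: min_def max_def)
  moreover have "\<phi> x = 0" if "x \<notin> {min p q - e..max p q + e}" for x
  proof (cases "x < min p q - e")
    case True
    then show ?thesis using left[of "x - p"] left[of "x - q"] by (simp add: \<phi>_def)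
  next
    case False
    then show ?thesis using that right[of "x - p"] right[of "x - q"] by (simp add: \<phi>_def)
  qed
  ultimately have \<phi>: "\<phi> \<in> test_functions a b"
    by (intro test_functionsI[where K = "{min p q - e..max p q + e}"]) auto
  have translate: "((\<lambda>x. \<Phi> (x - c)) has_field_derivative \<beta> (x - c)) (at x)" for x c
  proof -
    have "((\<lambda>x. x - c) has_field_derivative 1) (at x)"
      by (auto intro!: derivative_eq_intros)
    from DERIV_chain2[OF \<Phi> this] show ?thesis by simp
  qed
  have "(\<phi> has_field_derivative \<beta> (x - p) - \<beta> (x - q)) (at x)" for x
    using DERIV_diff[OF translate[of p x] translate[of q x]] by (simp add: \<phi>_def)
  then have deriv_\<phi>: "deriv \<phi> x = \<beta> (x - p) - \<beta> (x - q)" for x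
    by (rule DERIV_imp_deriv)
  \<comment> \<open>\<open>g\<close> is nonnegative: the bump at \<open>p\<close> lives where u < m,
    and the bump at \<open>q\<close>, which enters with a minus sign, lives where u > m. Its
    integral is zero, because both the constant \<open>m\<close> and \<open>u\<close> pair to zero
    with \<open>deriv \<phi>\<close>.\<close>
  define g where "g = (\<lambda>x. indicator ?I x *\<^sub>R ((m - u x) * deriv \<phi> x))"
  have cont: "continuous_on ?I (\<lambda>x. m - u x)"
    by (intro continuous_intros u)
  have int: "set_integrable lborel ?I (\<lambda>x. u x * deriv \<phi> x)" "set_integrable lborel ?I (\<lambda>x. m * deriv \<phi> x)"
    by (auto intro!: integrable_pairing u deriv_test_function \<phi>)
  have "g p = 0"
  proof (rule continuous_nonneg_integral_zero[where f = g])
    show "continuous_on UNIV g" "integrable lborel g"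
      using continuous_pairing[OF cont deriv_test_function[OF \<phi>]]
        integrable_pairing[OF cont deriv_test_function[OF \<phi>]]
      by (simp_all add: g_def set_integrable_def)
    have \<beta>_nonneg: "\<beta> x \<ge> 0" for x
      using \<beta>(2,3)[of x] by (cases "\<bar>x\<bar> < e") auto
    have "(m - u x) * \<beta> (x - p) \<ge> 0" for x
      using \<beta>_nonneg[of "x - p"] \<beta>(3)[of "x - p"] near_p[of x] by (cases "\<bar>x - p\<bar> < e") auto
    moreover have "(m - u x) * \<beta> (x - q) \<le> 0" for x
      using \<beta>_nonneg[of "x - q"] \<beta>(3)[of "x - q"] near_q[of x]
      by (cases "\<bar>x - q\<bar> < e") (auto simp: mult_nonpos_nonneg)
    ultimately have "(m - u x) * deriv \<phi> x \<ge> 0" for x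
      unfolding deriv_\<phi> right_diff_distrib by (smt (verit))
    then show "g x \<ge> 0" for x
      by (simp add: g_def)
    have "integral\<^sup>L lborel g = (LINT x:?I|lborel. m * deriv \<phi> x - u x * deriv \<phi> x)"
      by (simp add: g_def set_lebesgue_integral_def left_diff_distrib)
    also have "\<dots> = 0"
      using zero[OF \<phi>] integral_deriv_test_function[OF \<phi>] int by (simp add: set_integral_diff)
    finally show "integral\<^sup>L lborel g = 0" .
  qed
  \<comment> \<open>If \<open>p\<close> were within \<open>e\<close> of \<open>q\<close>, then u p
    would be both below and above \<open>m\<close>. Hence g p reduces to (m - u p) times the value
    of \<open>\<beta>\<close> at 0, which is positive.\<close>
  moreover have "\<beta> (p - q) = 0"
    using near_p[of p] near_q[of p] e \<beta>(3)[of "p - q"] by (cases "\<bar>p - q\<bar> < e") auto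
  ultimately show False
    using p m \<beta>(2)[of 0] e by (simp add: g_def deriv_\<phi>)
qed

text \<open>The inequality above assumes no order between \<open>p\<close> and \<open>q\<close>, so
  it may be applied both ways.\<close>

lemma zero_distributional_derivative_constant:
  assumes "continuous_on (real_interval a b) u"
    and "\<And>\<phi>. \<phi> \<in> test_functions a b \<Longrightarrow> (LINT x:real_interval a b|lborel. u x * deriv \<phi> x) = 0"
    and "p \<in> real_interval a b" "q \<in> real_interval a b"
  shows "u p = u q"
  using zero_distributional_derivative_le[OF assms(1,2)] assms(3,4) by (meson order_antisym)

section \<open>Distributional derivatives of continuous functions\<close>

lemma distr_deriv_of_fun:
  "\<phi> \<in> test_functions a b \<Longrightarrow>
    distr_deriv a b (distr_of_fun a b u) \<phi> = - (LINT x:real_interval a b|lborel. u x * deriv \<phi> x)"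
  by (simp add: distr_deriv_def distr_of_fun_def deriv_test_function)

lemma distr_deriv_of_fun_cong:
  assumes "\<And>x. x \<in> real_interval a b \<Longrightarrow> u x = v x"
  shows "distr_deriv a b (distr_of_fun a b u) = distr_deriv a b (distr_of_fun a b v)"
proof -
  have "distr_of_fun a b u = distr_of_fun a b v"
    unfolding distr_of_fun_def set_lebesgue_integral_def
    by (intro restrict_ext Bochner_Integration.integral_cong refl) (auto simp: indicator_def assms)
  then show ?thesis by simp
qed

text \<open>Continuity follows from one estimate: the values at \<open>\<phi> n\<close> and
  \<open>\<psi>\<close> differ by at most a uniform bound on the difference of the first
  derivatives, times the integral of |u| over a compact set containing all supports.\<close>

lemma distr_deriv_continuous_in_distributions:
  assumes u: "continuous_on (real_interval a b) u"
  shows "distr_deriv a b (distr_of_fun a b u) \<in> distributions a b"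
proof -
  let ?I = "real_interval a b" and ?T = "distr_deriv a b (distr_of_fun a b u)"
  have int: "set_integrable lborel ?I (\<lambda>x. u x * deriv \<phi> x)" if "\<phi> \<in> test_functions a b" for \<phi>
    by (intro integrable_pairing u deriv_test_function that)
  have "?T (\<lambda>x. c * \<phi> x + d * \<psi> x) = c * ?T \<phi> + d * ?T \<psi>"
    if \<phi>: "\<phi> \<in> test_functions a b" and \<psi>: "\<psi> \<in> test_functions a b" for \<phi> \<psi> c d
  proof -
    have "deriv (\<lambda>x. c * \<phi> x + d * \<psi> x) x = c * deriv \<phi> x + d * deriv \<psi> x" for x
      by (intro DERIV_imp_deriv DERIV_add DERIV_cmult test_function_has_derivative[OF \<phi>]
          test_function_has_derivative[OF \<psi>])
    then have "(LINT x:?I|lborel. u x * deriv (\<lambda>x. c * \<phi> x + d * \<psi> x) x)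
        = (LINT x:?I|lborel. c * (u x * deriv \<phi> x) + d * (u x * deriv \<psi> x))"
      by (simp add: algebra_simps)
    also have "\<dots> = c * (LINT x:?I|lborel. u x * deriv \<phi> x) + d * (LINT x:?I|lborel. u x * deriv \<psi> x)"
      using int[OF \<phi>] int[OF \<psi>] by (subst set_integral_add) auto
    finally show ?thesis
      using \<phi> \<psi> by (simp add: distr_deriv_of_fun linear_test_function)
  qed
  moreover have "(\<lambda>n. ?T (\<phi> n)) \<longlonglongrightarrow> ?T \<psi>" if conv: "test_converges a b \<phi> \<psi>" for \<phi> \<psi>
  proof -
    obtain K where \<phi>: "\<And>n. \<phi> n \<in> test_functions a b" and \<psi>: "\<psi> \<in> test_functions a b"
      and K: "compact K" "K \<subseteq> ?I" "\<And>n. supp (\<phi> n) \<subseteq> K"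
      and "\<And>m. uniform_limit UNIV (\<lambda>n. (deriv ^^ m) (\<phi> n)) ((deriv ^^ m) \<psi>) sequentially"
      using conv unfolding test_converges_def by blast
    from this(6)[of 1] have unif: "uniform_limit UNIV (\<lambda>n. deriv (\<phi> n)) (deriv \<psi>) sequentially"
      by simp
    \<comment> \<open>\<open>K\<close> is only known to contain the supports of the sequence, so the
      support of the limit is added.\<close>
    define L where "L = K \<union> supp \<psi>"
    have L: "compact L" "L \<subseteq> ?I"
      using K \<psi> by (auto simp: L_def test_functions_def)
    have outside: "deriv (\<phi> n) x = 0" "deriv \<psi> x = 0" if "x \<notin> L" for n x
      using that K(3) supp_deriv unfolding L_def by (blast intro: not_in_supp)+
    have w: "integrable lborel (\<lambda>x. indicator L x *\<^sub>R \<bar>u x\<bar>)"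
      using L u by (intro borel_integrable_compact continuous_intros) (auto intro: continuous_on_subset)
    define M where "M = (LINT x|lborel. indicator L x *\<^sub>R \<bar>u x\<bar>)"
    have "M \<ge> 0"
      unfolding M_def by (intro Bochner_Integration.integral_nonneg) auto
    have bound: "\<bar>?T (\<phi> n) - ?T \<psi>\<bar> \<le> \<delta> * M"
      if close: "\<And>x. dist (deriv (\<phi> n) x) (deriv \<psi> x) < \<delta>" for n \<delta>
    proof -
      have "\<bar>?T (\<phi> n) - ?T \<psi>\<bar> = \<bar>LINT x:?I|lborel. u x * deriv (\<phi> n) x - u x * deriv \<psi> x\<bar>"
        using \<phi>[of n] \<psi> int by (simp add: distr_deriv_of_fun set_integral_diff abs_minus_commute)
      also have "\<dots> \<le> (LINT x|lborel. \<bar>indicator ?I x *\<^sub>R (u x * deriv (\<phi> n) x - u x * deriv \<psi> x)\<bar>)"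
        unfolding set_lebesgue_integral_def by (rule integral_abs_bound)
      also have "\<dots> \<le> (LINT x|lborel. \<delta> * (indicator L x *\<^sub>R \<bar>u x\<bar>))"
      proof (rule integral_mono)
        show "integrable lborel (\<lambda>x. \<bar>indicator ?I x *\<^sub>R (u x * deriv (\<phi> n) x - u x * deriv \<psi> x)\<bar>)"
          using set_integral_diff(1)[OF int[OF \<phi>[of n]] int[OF \<psi>]]
          by (intro integrable_abs) (simp add: set_integrable_def)
        show "integrable lborel (\<lambda>x. \<delta> * (indicator L x *\<^sub>R \<bar>u x\<bar>))"
          by (intro integrable_mult_right w)
        fix x
        show "\<bar>indicator ?I x *\<^sub>R (u x * deriv (\<phi> n) x - u x * deriv \<psi> x)\<bar> \<le> \<delta> * (indicator L x *\<^sub>R \<bar>u x\<bar>)"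
        proof (cases "x \<in> L")
          case True
          have "\<bar>u x * deriv (\<phi> n) x - u x * deriv \<psi> x\<bar> = \<bar>deriv (\<phi> n) x - deriv \<psi> x\<bar> * \<bar>u x\<bar>"
            by (simp flip: right_diff_distrib add: abs_mult)
          also have "\<dots> \<le> \<delta> * \<bar>u x\<bar>"
            using close[of x] by (intro mult_right_mono) (auto simp: dist_real_def)
          finally show ?thesis using True L(2) by auto
        qed (simp add: outside)
      qed
      also have "\<dots> = \<delta> * M"
        by (simp add: M_def)
      finally show ?thesis .
    qed
    show ?thesis
    proof (rule tendstoI)
      fix e :: real assume e: "e > 0"
      \<comment> \<open>\<open>M\<close> may be 0; dividing by M + 1 is safe and still gives
        \<delta> M < e.\<close>
      define \<delta> where "\<delta> = e / (M + 1)"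
      have \<delta>: "\<delta> > 0" "\<delta> * M < e"
        using e \<open>M \<ge> 0\<close> by (auto simp: \<delta>_def field_simps)
      show "\<forall>\<^sub>F n in sequentially. dist (?T (\<phi> n)) (?T \<psi>) < e"
        using uniform_limitD[OF unif \<delta>(1)]
      proof eventually_elim
        case (elim n)
        then show ?case
          using bound[of n \<delta>] \<delta>(2) by (simp add: dist_real_def)
      qed
    qed
  qed
  ultimately show ?thesis
    by (auto simp: distributions_def distr_deriv_def)
qed

lemma distr_deriv_eq_imp_const_diff:
  assumes u: "continuous_on (real_interval a b) u" and v: "continuous_on (real_interval a b) v"
    and eq: "distr_deriv a b (distr_of_fun a b u) = distr_deriv a b (distr_of_fun a b v)"
    and pq: "p \<in> real_interval a b" "q \<in> real_interval a b"
  shows "u p - v p = u q - v q"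
proof -
  have "(LINT x:real_interval a b|lborel. (u x - v x) * deriv \<phi> x) = 0"
    if \<phi>: "\<phi> \<in> test_functions a b" for \<phi>
    using fun_cong[OF eq, of \<phi>] \<phi>
      integrable_pairing[OF u deriv_test_function[OF \<phi>]] integrable_pairing[OF v deriv_test_function[OF \<phi>]]
    by (simp add: distr_deriv_of_fun left_diff_distrib set_integral_diff)
  then show ?thesis
    using zero_distributional_derivative_constant[of a b "\<lambda>x. u x - v x" p q] pq
    by (auto intro!: continuous_intros u v)
qed

text \<open>Derivatives of test functions integrate to zero, so constants are invisible. This makes
  \<open>distr_subst\<close> independent of the chosen primitive.\<close>

lemma distr_deriv_add_const:
  assumes u: "continuous_on (real_interval a b) u"
  shows "distr_deriv a b (distr_of_fun a b (\<lambda>x. u x + c)) = distr_deriv a b (distr_of_fun a b u)"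
proof
  fix \<phi>
  show "distr_deriv a b (distr_of_fun a b (\<lambda>x. u x + c)) \<phi> = distr_deriv a b (distr_of_fun a b u) \<phi>"
  proof (cases "\<phi> \<in> test_functions a b")
    case \<phi>: True
    have "set_integrable lborel (real_interval a b) (\<lambda>x. c * deriv \<phi> x)"
      by (intro integrable_pairing deriv_test_function \<phi> continuous_intros)
    then show ?thesis
      using \<phi> integrable_pairing[OF u deriv_test_function[OF \<phi>]] integral_deriv_test_function[OF \<phi>]
      by (simp add: distr_deriv_of_fun distrib_right set_integral_add)
  qed (simp add: distr_deriv_def)
qed

section \<open>Primitives and integrals\<close>

lemma C0_continuous_on_real_interval:
  assumes "H \<in> C0 a b"
  shows "continuous_on (real_interval a b) (\<lambda>x. H (ereal x))"
  using assms unfolding C0_def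
  by (auto intro!: continuous_on_compose2[of "{a..b}" H] continuous_on_ereal continuous_on_id
      simp: real_interval_def)

text \<open>The difference of two primitives is constant on the open interval; it is continuous on
  the closure in \<open>ereal\<close>, which includes the endpoints even when they are
  infinite.\<close>

lemma primitive_unique:
  assumes "a < b" and H: "is_primitive a b H h" and K: "is_primitive a b K h"
    and "\<alpha> \<in> {a..b}" "\<beta> \<in> {a..b}"
  shows "H \<beta> - H \<alpha> = K \<beta> - K \<alpha>"
proof -
  have C0: "H \<in> C0 a b" "K \<in> C0 a b"
    using H K by (auto simp: is_primitive_def)
  obtain r where r: "r \<in> real_interval a b"
    using ereal_dense2[OF \<open>a < b\<close>] by (auto simp: real_interval_def)
  have "H x - K x = H (ereal r) - K (ereal r)" if "x \<in> {a..b}" for x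
  proof (rule continuous_constant_on_closure[of "{a<..<b}" "\<lambda>x. H x - K x"])
    show "continuous_on (closure {a<..<b}) (\<lambda>x. H x - K x)"
      using C0 \<open>a < b\<close> by (auto simp: C0_def intro!: continuous_intros)
    show "x \<in> closure {a<..<b}"
      using that \<open>a < b\<close> by simp
    fix y assume "y \<in> {a<..<b}"
    then obtain s where s: "y = ereal s" "s \<in> real_interval a b"
      by (cases y) (auto simp: real_interval_def)
    then show "H y - K y = H (ereal r) - K (ereal r)"
      using distr_deriv_eq_imp_const_diff[OF C0_continuous_on_real_interval[OF C0(1)]
          C0_continuous_on_real_interval[OF C0(2)] _ s(2) r] H K
      by (auto simp: is_primitive_def)
  qed
  from this[of \<alpha>] this[of \<beta>] show ?thesis
    using assms by linarith
qed

lemma distr_integral_eq: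
  assumes "a < b" and H: "is_primitive a b H h"
  shows "distr_integral a b h = H b - H a"
  unfolding distr_integral_def
proof (rule the_equality)
  fix I assume "\<exists>K. is_primitive a b K h \<and> I = K b - K a"
  then obtain K where K: "is_primitive a b K h" "I = K b - K a" by blast
  show "I = H b - H a"
    unfolding K(2) by (rule primitive_unique[OF \<open>a < b\<close> K(1) H]) (use \<open>a < b\<close> in simp_all)
qed (use H in blast)

lemma A_C_integral_eq:
  assumes F: "is_primitive (-\<infinity>) \<infinity> F f"
  shows "A_C_integral \<alpha> \<beta> f = F \<beta> - F \<alpha>"
  unfolding A_C_integral_def
proof (rule the_equality)
  fix I assume "\<exists>K. is_primitive (-\<infinity>) \<infinity> K f \<and> I = K \<beta> - K \<alpha>"
  then obtain K where K: "is_primitive (-\<infinity>) \<infinity> K f" "I = K \<beta> - K \<alpha>" by blast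
  show "I = F \<beta> - F \<alpha>"
    unfolding K(2) by (rule primitive_unique[OF _ K(1) F]) simp_all
qed (use F in blast)

text \<open>Another primitive \<open>E\<close> of \<open>f\<close> is F + c on the whole line, hence
  E \<circ> G is F \<circ> G + c, with the same distributional derivative.\<close>

lemma distr_subst_eq:
  assumes F: "continuous_on UNIV F" "distr_deriv (-\<infinity>) \<infinity> (distr_of_fun (-\<infinity>) \<infinity> F) = f"
    and G: "continuous_on (real_interval a b) G"
  shows "distr_subst a b f G = distr_deriv a b (distr_of_fun a b (F \<circ> G))"
  unfolding distr_subst_def
proof (rule the_equality)
  fix h
  assume "\<exists>E. continuous_on UNIV E \<and> distr_deriv (-\<infinity>) \<infinity> (distr_of_fun (-\<infinity>) \<infinity> E) = f \<and>
    h = distr_deriv a b (distr_of_fun a b (E \<circ> G))"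
  then obtain E where E: "continuous_on UNIV E" "distr_deriv (-\<infinity>) \<infinity> (distr_of_fun (-\<infinity>) \<infinity> E) = f"
    "h = distr_deriv a b (distr_of_fun a b (E \<circ> G))" by blast
  define c where "c = E 0 - F 0"
  have "E x - F x = c" for x
    using distr_deriv_eq_imp_const_diff[of "-\<infinity>" \<infinity> E F x 0] E F by (simp add: c_def)
  then have "E = (\<lambda>x. F x + c)"
    by (simp add: fun_eq_iff algebra_simps)
  moreover have "continuous_on (real_interval a b) (F \<circ> G)"
    using F(1) G by (intro continuous_on_compose) (auto intro: continuous_on_subset)
  ultimately show "h = distr_deriv a b (distr_of_fun a b (F \<circ> G))"
    using E(3) distr_deriv_add_const[of a b "F \<circ> G" c] by (simp add: comp_def)
qed (use F in blast)

text \<open>Common core of both halves of the theorem: \<open>H\<close> agrees with F \<circ> G only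
  in the interior, and membership in \<open>C0\<close> fixes its values at the ends. So
  \<open>G\<close> may diverge there.\<close>

lemma distr_integral_subst:
  assumes F: "is_primitive (-\<infinity>) \<infinity> F f" and "a < b" and H: "H \<in> C0 a b"
    and G: "continuous_on (real_interval a b) (\<lambda>t. G (ereal t))"
    and HG: "\<And>x. a < x \<Longrightarrow> x < b \<Longrightarrow> H x = F (ereal (G x))"
  shows "distr_integrable a b (distr_subst a b f (\<lambda>t. G (ereal t)))"
    and "distr_integral a b (distr_subst a b f (\<lambda>t. G (ereal t))) = H b - H a"
proof -
  let ?h = "distr_subst a b f (\<lambda>t. G (ereal t))"
  have "continuous_on UNIV (\<lambda>x. F (ereal x))"
    using C0_continuous_on_real_interval[of F "-\<infinity>" \<infinity>] F by (simp add: is_primitive_def)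
  then have "?h = distr_deriv a b (distr_of_fun a b ((\<lambda>x. F (ereal x)) \<circ> (\<lambda>t. G (ereal t))))"
    using F G by (intro distr_subst_eq) (auto simp: is_primitive_def)
  also have "\<dots> = distr_deriv a b (distr_of_fun a b (\<lambda>x. H (ereal x)))"
    by (rule distr_deriv_of_fun_cong) (simp add: HG real_interval_def)
  finally have h: "?h = distr_deriv a b (distr_of_fun a b (\<lambda>x. H (ereal x)))" .
  then have prim: "is_primitive a b H ?h"
    using H by (simp add: is_primitive_def)
  then show "distr_integrable a b ?h"
    using distr_deriv_continuous_in_distributions[OF C0_continuous_on_real_interval[OF H]]
    by (auto simp: distr_integrable_def h)
  show "distr_integral a b ?h = H b - H a"
    by (rule distr_integral_eq[OF \<open>a < b\<close> prim])
qed

text \<open>The one-sided limits of \<open>G\<close> are taken in \<open>ereal\<close>, so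
  \<open>at_right a\<close> and \<open>at_left b\<close> cover infinite endpoints too. Integrability
  is a separate conjunct because a definite description has some value even without a
  primitive.\<close>

theorem theorem11:
  fixes f :: "(real \<Rightarrow> real) \<Rightarrow> real" and F :: "ereal \<Rightarrow> real" and a b :: ereal
  assumes "f \<in> A_C"
    and "F \<in> C0 (-\<infinity>) \<infinity>"
    and "distr_deriv (-\<infinity>) \<infinity> (distr_of_fun (-\<infinity>) \<infinity> (\<lambda>x. F (ereal x))) = f"
    and "a < b"
  shows "(\<forall>G \<in> C0 a b.
           distr_integrable a b (distr_subst a b f (\<lambda>t. G (ereal t))) \<and>
           A_C_integral (ereal (G a)) (ereal (G b)) f
             = distr_integral a b (distr_subst a b f (\<lambda>t. G (ereal t))) \<and>
           distr_integral a b (distr_subst a b f (\<lambda>t. G (ereal t)))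
             = F (ereal (G b)) - F (ereal (G a))) \<and>
         (\<forall>G::ereal \<Rightarrow> real.
           continuous_on {a<..<b} G \<and>
           filterlim G at_bot (at_right a) \<and>
           filterlim G at_top (at_left b) \<longrightarrow>
           distr_integrable a b (distr_subst a b f (\<lambda>t. G (ereal t))) \<and>
           A_C_integral (-\<infinity>) \<infinity> f = distr_integral a b (distr_subst a b f (\<lambda>t. G (ereal t))) \<and>
           distr_integral a b (distr_subst a b f (\<lambda>t. G (ereal t))) = F \<infinity> - F (-\<infinity>))"
proof (intro conjI ballI allI impI; (elim conjE)?)
  have F: "is_primitive (-\<infinity>) \<infinity> F f"
    using assms by (simp add: is_primitive_def)
  have contF: "continuous_on UNIV F"
  proof -
    have "{-\<infinity>..\<infinity>} = (UNIV :: ereal set)" by auto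
    with assms(2) show ?thesis by (simp add: C0_def)
  qed
  {
    fix G assume G: "G \<in> C0 a b"
    have "(\<lambda>x. F (ereal (G x))) \<in> C0 a b"
      using G by (auto simp: C0_def intro!: continuous_on_compose2[OF contF] continuous_on_ereal)
    \<comment> \<open>Here \<open>G\<close> is finite and continuous up to the ends, so F \<circ> G
      itself serves as \<open>H\<close>.\<close>
    note subst = distr_integral_subst[OF F assms(4) this C0_continuous_on_real_interval[OF G] refl]
    show "distr_integrable a b (distr_subst a b f (\<lambda>t. G (ereal t)))"
      by (rule subst)
    show "distr_integral a b (distr_subst a b f (\<lambda>t. G (ereal t))) = F (ereal (G b)) - F (ereal (G a))"
      by (rule subst)
    then show "A_C_integral (ereal (G a)) (ereal (G b)) f
        = distr_integral a b (distr_subst a b f (\<lambda>t. G (ereal t)))"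
      by (simp add: A_C_integral_eq[OF F])
  }
  {
    fix G :: "ereal \<Rightarrow> real"
    assume G: "continuous_on {a<..<b} G" "filterlim G at_bot (at_right a)" "filterlim G at_top (at_left b)"
    \<comment> \<open>The values \<open>G a\<close> and \<open>G b\<close> are arbitrary real
      numbers here, unrelated to the limits, so the end values of \<open>H\<close> are set to those
      of \<open>F\<close> at the infinite limits.\<close>
    define H where "H = (\<lambda>x. if x \<le> a then F (-\<infinity>) else if b \<le> x then F \<infinity> else F (ereal (G x)))"
    \<comment> \<open>Using \<open>nhds\<close> instead of a punctured neighbourhood allows
      composition without checking that the inner function avoids its limit.\<close>
    have F_tendsto: "(F \<longlongrightarrow> F l) (nhds l)" for l
      using contF by (simp add: continuous_on_eq_continuous_at continuous_at tendsto_nhds_iff)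
    have H_ends: "H a = F (-\<infinity>)" "H b = F \<infinity>"
      using assms(4) by (simp_all add: H_def flip: not_less)
    have H_inner: "F (ereal (G x)) = H x" if "a < x" "x < b" for x
      using that by (simp add: H_def flip: not_less)
    have "continuous_on {a..b} H"
    proof (rule continuous_on_IccI[OF _ _ _ assms(4)])
      have "((\<lambda>x. ereal (G x)) \<longlongrightarrow> -\<infinity>) (at_right a)" "((\<lambda>x. ereal (G x)) \<longlongrightarrow> \<infinity>) (at_left b)"
        using G(2,3) by (simp_all add: tendsto_PInfty_eq_at_top tendsto_MInfty filterlim_at_bot_dense)
      then have "((\<lambda>x. F (ereal (G x))) \<longlongrightarrow> F (-\<infinity>)) (at_right a)"
        "((\<lambda>x. F (ereal (G x))) \<longlongrightarrow> F \<infinity>) (at_left b)"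
        using filterlim_compose[OF F_tendsto] by blast+
      then show "(H \<longlongrightarrow> H a) (at_right a)" "(H \<longlongrightarrow> H b) (at_left b)"
        using eventually_at_rightI[of a b, OF H_inner assms(4)] eventually_at_leftI[of a b, OF H_inner assms(4)]
        by (auto simp: H_ends elim: Lim_transform_eventually)
    next
      fix x assume x: "a < x" "x < b"
      have "continuous_on {a<..<b} (\<lambda>x. F (ereal (G x)))"
        by (rule continuous_on_compose2[OF contF]) (auto intro!: continuous_on_ereal G(1))
      then have "continuous_on {a<..<b} H"
        by (rule continuous_on_eq) (simp add: H_inner)
      with x show "H \<midarrow>x\<rightarrow> H x"
        by (simp add: continuous_on_eq_continuous_at continuous_at)
    qed
    then have "H \<in> C0 a b" by (simp add: C0_def)
    moreover have "continuous_on (real_interval a b) (\<lambda>t. G (ereal t))"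
      by (rule continuous_on_compose2[OF G(1)])
         (auto intro!: continuous_on_ereal continuous_on_id simp: real_interval_def)
    ultimately have subst: "distr_integrable a b (distr_subst a b f (\<lambda>t. G (ereal t)))"
      "distr_integral a b (distr_subst a b f (\<lambda>t. G (ereal t))) = H b - H a"
      using distr_integral_subst[OF F assms(4), of H G] H_inner by auto
    then show "distr_integrable a b (distr_subst a b f (\<lambda>t. G (ereal t)))"
      by blast
    show "distr_integral a b (distr_subst a b f (\<lambda>t. G (ereal t))) = F \<infinity> - F (-\<infinity>)"
      using subst by (simp add: H_ends)
    then show "A_C_integral (-\<infinity>) \<infinity> f = distr_integral a b (distr_subst a b f (\<lambda>t. G (ereal t)))"
      by (simp add: A_C_integral_eq[OF F])
  }
qed

end
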